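(* Let $0\le\alpha<1$, $n\in\mathbb{N}$, and $\zeta\in\mathbb{C}$ with $|\zeta|\le\frac{1}{2n-1}$. Let $f=h+\overline{g}$ be harmonic in $\mathbb{D}=\{|z|<1\}$ with $h(0)=g(0)=0$, $h'(0)=1$, such that $\operatorname{Re}\big(1+\frac{zh''(z)}{h'(z)}\big)>\alpha$ and $g'(z)=\zeta z^nh'(z)$ for all $z\in\mathbb{D}$. Then for $0<r<1$ the area $\mathcal{A}(f(\mathbb{D}_r))$ of $f(\mathbb{D}_r)$, where $\mathbb{D}_r=\{|z|<r\}$, satisfies $$2\pi\int_0^r\frac{\rho(1-|\zeta|^2\rho^{2n})}{(1+\rho)^{4(1-\alpha)}}\,d\rho\le\mathcal{A}(f(\mathbb{D}_r))\le2\pi\int_0^r\frac{\rho(1-|\zeta|^2\rho^{2n})}{(1-\rho)^{4(1-\alpha)}}\,d\rho.$$ *)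

theory Defs
  imports "HOL-Analysis.Analysis"
begin

end

theory Submission
  imports Defs "HOL-Complex_Analysis.Complex_Analysis"
begin

text \<open>
  The condition on \<open>h\<close> says that the argument of the tangent \<open>i z h'(z)\<close> increases along each circle
  \<open>|z| = \<rho>\<close>, by \<open>2\<pi>\<close> in total. Hence every point of the image curve is a strict support point,
  so \<open>h\<close> is injective and the images of discs are convex. On the convex set \<open>h(\<D>\<^sub>r)\<close> the function \<open>g \<circ> h\<^sup>-\<^sup>1\<close> is a
  contraction, so \<open>f\<close> is injective and its area is the integral of the Jacobian
  \<open>|h'|\<^sup>2 (1 - |\<zeta>|\<^sup>2 |z|\<^sup>2\<^sup>n)\<close>. The Schwarz lemma bounds the radial derivative of \<open>log |h'|\<close>, and integrating it
  gives the distortion bounds on \<open>|h'|\<close> that finish the proof in polar coordinates.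
\<close>

unbundle no fps_syntax

section \<open>Area in the complex plane\<close>

text \<open>Lebesgue measure is determined by its values on open boxes, and a box in the complex
  plane pulls back to a box in \<open>real^2\<close> with the same side lengths. This moves measures
  and integrals between the two spaces.\<close>

lemma distr_lborel_Complex:
  "distr lborel borel (\<lambda>v::real^2. Complex (v $ 1) (v $ 2)) = (lborel :: complex measure)"
proof (rule sym, rule lborel_eqI)
  fix l u :: complex
  assume le: "\<And>b. b \<in> Basis \<Longrightarrow> l \<bullet> b \<le> u \<bullet> b"
  let ?v = "\<lambda>z::complex. vector [Re z, Im z] :: real^2"
  have [measurable]: "(\<lambda>v::real^2. Complex (v $ 1) (v $ 2)) \<in> borel_measurable borel"
    by (intro borel_measurable_continuous_onI continuous_intros)
  have vimage: "(\<lambda>v::real^2. Complex (v $ 1) (v $ 2)) -` box l u = box (?v l) (?v u)"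
    by (auto simp: mem_box_cart mem_box Basis_complex_def forall_2)
  have le1: "Re l \<le> Re u" "Im l \<le> Im u"
    using le[of 1] le[of \<i>] by (auto simp: Basis_complex_def)
  have nonempty: "cbox (?v l) (?v u) \<noteq> {}"
    using le1 by (auto simp: interval_ne_empty_cart forall_2)
  have "emeasure lborel (box (?v l) (?v u)) = ennreal (measure lborel (cbox (?v l) (?v u)))"
    using emeasure_lborel_box_finite[of "?v l" "?v u"]
    by (subst emeasure_eq_ennreal_measure) (auto simp: measure_lborel_box_eq measure_lborel_cbox_eq)
  also have "measure lborel (cbox (?v l) (?v u)) = (\<Prod>b\<in>Basis. (u - l) \<bullet> b)"
    using content_cbox_cart[OF nonempty] by (simp add: UNIV_2 Basis_complex_def)
  finally show "emeasure (distr lborel borel (\<lambda>v::real^2. Complex (v $ 1) (v $ 2))) (box l u)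
      = ennreal (\<Prod>b\<in>Basis. (u - l) \<bullet> b)"
    by (simp add: emeasure_distr vimage)
qed simp

text \<open>The change of variables formula on \<open>real^2\<close> is conjugated by the coordinate
  isomorphism. \<open>J\<close> is the Jacobian determinant, its columns being the values of the
  real-linear map \<open>f' z\<close> at 1 and at the imaginary unit. The derivative is only real,
  since it will be applied to a harmonic map.\<close>

lemma measure_image_complex:
  fixes f :: "complex \<Rightarrow> complex" and f' :: "complex \<Rightarrow> complex \<Rightarrow> complex"
  defines "J \<equiv> \<lambda>z. Re (f' z 1) * Im (f' z \<i>) - Im (f' z 1) * Re (f' z \<i>)"
  assumes S: "open S" and f': "\<And>z. z \<in> S \<Longrightarrow> (f has_derivative f' z) (at z)"
    and inj: "inj_on f S" and bdd: "bounded (f ` S)" and J: "continuous_on S J"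
  shows "ennreal (measure lebesgue (f ` S)) = (\<integral>\<^sup>+z\<in>S. ennreal \<bar>J z\<bar> \<partial>lborel)"
proof -
  define c where "c = (\<lambda>v::real^2. Complex (v $ 1) (v $ 2))"
  define d where "d = (\<lambda>z::complex. vector [Re z, Im z] :: real^2)"
  have cd[simp]: "c (d z) = z" for z by (simp add: c_def d_def)
  have dc[simp]: "d (c v) = v" for v by (simp add: c_def d_def vec_eq_iff forall_2)
  have lin_c: "linear c"
    by (rule linearI) (auto simp: c_def complex_eq_iff)
  have lin_d: "linear d"
    by (rule linearI) (auto simp: d_def vec_eq_iff forall_2)
  have blc: "bounded_linear c" and bld: "bounded_linear d"
    using lin_c lin_d by (auto simp: linear_linear)
  have conc: "continuous_on A c" for A using blc by (rule linear_continuous_on)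
  have [measurable]: "c \<in> borel_measurable borel" "c \<in> borel_measurable lborel"
    using conc[of UNIV] by (auto intro!: borel_measurable_continuous_onI)
  have image_vimage: "d ` X = c -` X" for X
    by (force simp: image_iff)
  have lborel_c: "lborel = distr lborel borel c"
    unfolding c_def by (rule distr_lborel_Complex [symmetric])
  define T where "T = c -` S"
  define F where "F = d \<circ> f \<circ> c"
  define F' where "F' = (\<lambda>v. d \<circ> f' (c v) \<circ> c)"
  have T: "open T" unfolding T_def using S conc[of UNIV] by (auto intro: open_vimage)
  have FT: "F ` T = d ` (f ` S)"
    unfolding F_def T_def image_vimage[symmetric] image_comp by (simp add: o_def)
  have "continuous_on S f"
    using f' has_derivative_continuous continuous_at_imp_continuous_on by blast
  \<comment> \<open>By invariance of domain the image is open, hence Borel, so its measure is the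
    same under \<open>lebesgue\<close> and \<open>lborel\<close>.\<close>
  then have fS: "open (f ` S)"
    by (intro invariance_of_domain S inj)
  then have oFT: "open (F ` T)"
    unfolding FT image_vimage using conc[of UNIV] by (auto intro: open_vimage)
  have bFT: "bounded (F ` T)"
    unfolding FT using bdd bld by (rule bounded_linear_image)
  have inj': "inj_on F T"
    using inj unfolding F_def T_def inj_on_def by (metis cd comp_def dc vimageE)
  have der: "(F has_derivative F' v) (at v within T)" if "v \<in> T" for v
  proof (rule has_derivative_at_withinI)
    have "(c has_derivative c) (at v)" using blc by (rule bounded_linear_imp_has_derivative)
    moreover have "(f has_derivative f' (c v)) (at (c v))" using that f' by (auto simp: T_def)
    moreover have "(d has_derivative d) (at (f (c v)))" using bld by (rule bounded_linear_imp_has_derivative)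
    ultimately show "(F has_derivative F' v) (at v)"
      unfolding F_def F'_def by (metis diff_chain_at comp_def)
  qed
  have det: "det (matrix (F' v)) = J (c v)" if "v \<in> T" for v
  proof -
    have "c (axis 1 1) = 1" "c (axis 2 1) = \<i>"
      by (auto simp: c_def axis_def complex_eq_iff)
    then show ?thesis
      by (simp add: det_2 matrix_def F'_def d_def J_def mult.commute)
  qed
  have "(\<lambda>z. indicat_real S z *\<^sub>R \<bar>J z\<bar>) \<in> borel_measurable borel"
    using S J by (intro borel_measurable_continuous_on_indicator continuous_intros) (auto simp: borel_open)
  then have "(\<lambda>z. ennreal (indicat_real S z *\<^sub>R \<bar>J z\<bar>)) \<in> borel_measurable borel"
    by measurable
  also have "(\<lambda>z. ennreal (indicat_real S z *\<^sub>R \<bar>J z\<bar>)) = (\<lambda>z. ennreal \<bar>J z\<bar> * indicator S z)"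
    by (auto simp: indicator_def fun_eq_iff)
  finally have meas: "(\<lambda>z. ennreal \<bar>J z\<bar> * indicator S z) \<in> borel_measurable borel" .
  \<comment> \<open>The change of variables theorem is an equivalence between the image having
    measure m and the Jacobian having integral m. It is read from left to right: boundedness of the
    image gives finite measure, and integrability of the Jacobian follows.\<close>
  have "F ` T \<in> lmeasurable \<and> measure lebesgue (F ` T) = measure lebesgue (F ` T)"
    using bFT oFT by (simp add: lmeasurable_open)
  then have "((\<lambda>v. \<bar>det (matrix (F' v))\<bar>) has_integral measure lebesgue (F ` T)) T"
    using iffD1[OF has_measure_differentiable_image[OF _ der inj', of "measure lebesgue (F ` T)"]] T by (simp add: borel_open)
  then have "((\<lambda>v. \<bar>J (c v)\<bar>) has_integral measure lebesgue (F ` T)) T"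
    using det by (smt (verit, best) has_integral_eq)
  then have "ennreal (measure lebesgue (F ` T)) = (\<integral>\<^sup>+v\<in>T. ennreal \<bar>J (c v)\<bar> \<partial>lborel)"
    by (subst nn_integral_has_integral_lebesgue'[where I="measure lebesgue (F ` T)"]) auto
  also have "\<dots> = (\<integral>\<^sup>+v. ennreal \<bar>J (c v)\<bar> * indicator S (c v) \<partial>lborel)"
    by (intro nn_integral_cong) (auto simp: T_def indicator_def)
  also have "\<dots> = (\<integral>\<^sup>+z. ennreal \<bar>J z\<bar> * indicator S z \<partial>distr lborel borel c)"
    using nn_integral_distr[of c lborel borel "\<lambda>z. ennreal \<bar>J z\<bar> * indicator S z"] meas by simp
  finally have "ennreal (measure lebesgue (F ` T)) = (\<integral>\<^sup>+z\<in>S. ennreal \<bar>J z\<bar> \<partial>lborel)"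
    using lborel_c by simp
  moreover have "measure lebesgue (F ` T) = measure lborel (c -` (f ` S))"
    using oFT FT image_vimage by (simp add: borel_open)
  moreover have "\<dots> = measure (distr lborel borel c) (f ` S)"
    using fS by (subst measure_distr) (auto simp: borel_open)
  moreover have "\<dots> = measure lebesgue (f ` S)"
    using fS lborel_c by (simp add: borel_open)
  ultimately show ?thesis by simp
qed

section \<open>Polar coordinates for radial integrands\<close>

lemma emeasure_ball_complex: "0 \<le> r \<Longrightarrow> emeasure lborel (ball (0::complex) r) = ennreal (pi * r\<^sup>2)"
  by (simp add: emeasure_ball unit_ball_vol_2)

text \<open>Pushing area on the ball forward along \<open>norm\<close> gives a measure on the line.
  Its mass beyond \<open>x\<close> is the area of an annulus, which is the integral of the
  circumference \<open>2 * pi * \<rho>\<close> from \<open>x\<close> to \<open>r\<close>. So the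
  pushforward has that circumference as density, and no angular variable is needed.\<close>

lemma nn_integral_radial_complex:
  fixes p :: "real \<Rightarrow> ennreal"
  assumes [measurable]: "p \<in> borel_measurable borel" and r: "0 \<le> r"
  shows "(\<integral>\<^sup>+z\<in>ball (0::complex) r. p (norm z) \<partial>lborel) = (\<integral>\<^sup>+\<rho>\<in>{0..r}. ennreal (2 * pi * \<rho>) * p \<rho> \<partial>lborel)"
proof -
  let ?M = "density (lborel :: complex measure) (indicator (ball 0 r))"
  let ?N = "density lborel (\<lambda>\<rho>. ennreal (2 * pi * \<rho>) * indicator {0..r} \<rho>)"
  have shell: "emeasure lborel {z::complex. norm z < r \<and> x < norm z} = ennreal (pi * (r\<^sup>2 - x\<^sup>2))"
    if "0 \<le> x" "x < r" for x
  proof -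
    have "{z::complex. norm z < r \<and> x < norm z} = ball 0 r - cball 0 x"
      by auto
    then have "emeasure lborel {z::complex. norm z < r \<and> x < norm z}
        = emeasure lborel (ball (0::complex) r) - emeasure lborel (cball (0::complex) x)"
      using that by (simp add: emeasure_Diff emeasure_cball subset_iff)
    also have "\<dots> = ennreal (pi * r\<^sup>2) - ennreal (pi * x\<^sup>2)"
      using that r by (simp add: emeasure_ball_complex emeasure_cball unit_ball_vol_2)
    finally show ?thesis using that by (simp add: ennreal_minus algebra_simps)
  qed
  have annulus: "(\<integral>\<^sup>+\<rho>\<in>{x..r}. ennreal (2 * pi * \<rho>) \<partial>lborel) = ennreal (pi * (r\<^sup>2 - x\<^sup>2))"
    if "0 \<le> x" "x \<le> r" for x
  proof (rule nn_integral_has_integral_lebesgue')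
    have "((\<lambda>\<rho>. 2 * pi * \<rho>) has_integral (pi * r\<^sup>2 - pi * x\<^sup>2)) {x..r}"
      by (intro fundamental_theorem_of_calculus that)
         (auto intro!: derivative_eq_intros simp flip: has_real_derivative_iff_has_vector_derivative)
    then show "((\<lambda>\<rho>. 2 * pi * \<rho>) has_integral pi * (r\<^sup>2 - x\<^sup>2)) {x..r}"
      by (simp add: algebra_simps)
  qed (use that in auto)
  \<comment> \<open>Two measures that are finite and equal on all half-lines \<open>{x<..}\<close>
    coincide.\<close>
  have "distr ?M borel norm = ?N"
  proof (rule measure_eqI_lessThan)
    fix x :: real
    have "emeasure (distr ?M borel norm) {x<..} = emeasure ?M {z. x < norm z}"
      by (subst emeasure_distr) (auto simp: vimage_def)
    also have "\<dots> = emeasure lborel {z::complex. norm z < r \<and> x < norm z}"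
      by (subst emeasure_density)
         (auto intro!: arg_cong[where f="emeasure lborel"] simp flip: indicator_inter_arith simp: ball_def nn_integral_indicator)
    finally have M: "emeasure (distr ?M borel norm) {x<..} = emeasure lborel {z::complex. norm z < r \<and> x < norm z}" .
    have N: "emeasure ?N {x<..} = (\<integral>\<^sup>+\<rho>. ennreal (2 * pi * \<rho>) * indicator {0..r} \<rho> * indicator {x<..} \<rho> \<partial>lborel)"
      by (subst emeasure_density) auto
    consider "x < 0" | "0 \<le> x" "x < r" | "r \<le> x" "0 \<le> x" by linarith
    then have eq: "emeasure lborel {z::complex. norm z < r \<and> x < norm z} = emeasure ?N {x<..}
        \<and> emeasure ?N {x<..} < \<infinity>"
    proof cases
      case 1
      then have "{z::complex. norm z < r \<and> x < norm z} = ball 0 r"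
        by (auto simp: ball_def intro: less_le_trans[OF _ norm_ge_zero])
      moreover have "emeasure ?N {x<..} = (\<integral>\<^sup>+\<rho>\<in>{0..r}. ennreal (2 * pi * \<rho>) \<partial>lborel)"
        unfolding N using 1 by (intro nn_integral_cong) (auto simp: indicator_def)
      ultimately show ?thesis using annulus[of 0] r by (simp add: emeasure_ball_complex)
    next
      case 2
      \<comment> \<open>The two domains of integration differ only in the point \<open>x\<close>, a
        null set.\<close>
      have "emeasure ?N {x<..} = (\<integral>\<^sup>+\<rho>\<in>{x..r}. ennreal (2 * pi * \<rho>) \<partial>lborel)"
        unfolding N using 2 AE_lborel_singleton[of x]
        by (intro nn_integral_cong_AE) (auto simp: indicator_def)
      then show ?thesis using annulus[of x] shell[of x] 2 by simp
    next
      case 3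
      then have empty: "{z::complex. norm z < r \<and> x < norm z} = {}" by auto
      have "emeasure ?N {x<..} = (\<integral>\<^sup>+\<rho>. 0 \<partial>(lborel :: real measure))"
        unfolding N using 3 by (intro nn_integral_cong) (auto simp: indicator_def)
      then show ?thesis by (simp add: empty)
    qed
    show "emeasure (distr ?M borel norm) {x<..} < \<infinity>" "emeasure (distr ?M borel norm) {x<..} = emeasure ?N {x<..}"
      using M eq by auto
  qed auto
  then have "(\<integral>\<^sup>+\<rho>. p \<rho> \<partial>distr ?M borel norm) = (\<integral>\<^sup>+\<rho>. p \<rho> \<partial>?N)" by simp
  moreover have "(\<integral>\<^sup>+\<rho>. p \<rho> \<partial>distr ?M borel norm) = (\<integral>\<^sup>+z\<in>ball (0::complex) r. p (norm z) \<partial>lborel)"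
  proof -
    have [measurable]: "(indicator (ball (0::complex) r) :: complex \<Rightarrow> ennreal) \<in> borel_measurable borel"
      by (rule borel_measurable_indicator) simp
    show ?thesis
      by (subst nn_integral_distr) (auto simp: nn_integral_density mult.commute)
  qed
  moreover have "(\<integral>\<^sup>+\<rho>. p \<rho> \<partial>?N) = (\<integral>\<^sup>+\<rho>\<in>{0..r}. ennreal (2 * pi * \<rho>) * p \<rho> \<partial>lborel)"
    by (simp add: nn_integral_density mult_ac)
  ultimately show ?thesis by simp
qed

lemma nn_integral_radial_continuous:
  fixes p :: "real \<Rightarrow> real"
  assumes r: "0 \<le> r" and p: "continuous_on {0..r} p" "\<And>\<rho>. 0 \<le> \<rho> \<Longrightarrow> \<rho> \<le> r \<Longrightarrow> 0 \<le> p \<rho>"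
  shows "(\<integral>\<^sup>+z\<in>ball (0::complex) r. ennreal (p (norm z)) \<partial>lborel)
      = ennreal (2 * pi * integral {0..r} (\<lambda>\<rho>. \<rho> * p \<rho>))"
proof -
  \<comment> \<open>\<open>p\<close> is continuous only on \<open>{0..r}\<close>; cutting it off
    outside makes it Borel on the whole line and leaves both integrals unchanged.\<close>
  define P where "P = (\<lambda>\<rho>. ennreal (indicat_real {0..r} \<rho> *\<^sub>R p \<rho>))"
  have "(\<lambda>\<rho>. indicat_real {0..r} \<rho> *\<^sub>R p \<rho>) \<in> borel_measurable borel"
    using p by (intro borel_measurable_continuous_on_indicator) auto
  then have P: "P \<in> borel_measurable borel" unfolding P_def by measurable
  have "(\<integral>\<^sup>+z\<in>ball (0::complex) r. ennreal (p (norm z)) \<partial>lborel) = (\<integral>\<^sup>+z\<in>ball (0::complex) r. P (norm z) \<partial>lborel)"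
    by (intro nn_integral_cong) (auto simp: P_def indicator_def)
  also have "\<dots> = (\<integral>\<^sup>+\<rho>\<in>{0..r}. ennreal (2 * pi * \<rho>) * P \<rho> \<partial>lborel)"
    by (rule nn_integral_radial_complex[OF P r])
  also have "\<dots> = (\<integral>\<^sup>+\<rho>\<in>{0..r}. ennreal (2 * pi * (\<rho> * p \<rho>)) \<partial>lborel)"
    using p by (intro nn_integral_cong) (auto simp: P_def indicator_def mult.assoc simp flip: ennreal_mult)
  also have "\<dots> = ennreal (2 * pi * integral {0..r} (\<lambda>\<rho>. \<rho> * p \<rho>))"
  proof (rule nn_integral_has_integral_lebesgue')
    have "(\<lambda>\<rho>. \<rho> * p \<rho>) integrable_on {0..r}"
      by (intro integrable_continuous_interval continuous_intros p)
    then show "((\<lambda>\<rho>. 2 * pi * (\<rho> * p \<rho>)) has_integral 2 * pi * integral {0..r} (\<lambda>\<rho>. \<rho> * p \<rho>)) {0..r}"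
      by (intro has_integral_mult_right integrable_integral)
  qed (use p in auto)
  finally show ?thesis .
qed

section \<open>Convex functions on the disc\<close>

text \<open>Geometrically, \<open>w * deriv h w\<close> is the outer normal of the image curve at
  \<open>h w\<close>, and every other point of the curve lies strictly on the inner side of the
  tangent there. The height below the tangent vanishes at both ends of one full circuit. Its
  derivative has the sign of the sine of the turning angle, which increases from 0 to 2 pi, so the
  height first rises and then falls.\<close>

lemma convex_function_support_circle:
  assumes holh: "h holomorphic_on ball 0 1"
    and nz: "\<And>z. z \<in> ball 0 1 \<Longrightarrow> deriv h z \<noteq> 0"
    and cvx: "\<And>z. z \<in> ball 0 1 \<Longrightarrow> 0 < Re (1 + z * deriv (deriv h) z / deriv h z)"
    and w: "w \<noteq> 0" "norm w < 1" and z: "norm z = norm w" "z \<noteq> w"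
  shows "0 < Re ((h w - h z) / (w * deriv h w))"
proof -
  have holh': "deriv h holomorphic_on ball 0 1"
    using holh by (intro holomorphic_deriv) auto
  \<comment> \<open>A holomorphic logarithm of \<open>deriv h\<close> supplies a smooth branch of
    its argument along the circle.\<close>
  obtain L where L: "L holomorphic_on ball 0 1" "\<And>z. z \<in> ball 0 1 \<Longrightarrow> exp (L z) = deriv h z"
    using holomorphic_logarithm_exists[OF convex_ball open_ball holh' nz, of 0] by auto
  define \<rho> where "\<rho> = norm w"
  define s where "s = Arg w"
  define \<gamma> where "\<gamma> = (\<lambda>t. complex_of_real \<rho> * cis t)"
  \<comment> \<open>\<open>\<psi>\<close> is an argument of z h'(z) on the circle, and
    \<open>u\<close> below is the height of the curve below the tangent at \<open>h w\<close>, up to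
    a positive factor.\<close>
  define \<psi> where "\<psi> = (\<lambda>t. t + Im (L (\<gamma> t)))"
  define u where "u = (\<lambda>t. Re ((h w - h (\<gamma> t)) / (w * deriv h w)))"
  have \<rho>: "0 < \<rho>" "\<rho> < 1" using w by (auto simp: \<rho>_def)
  have \<gamma>_in: "\<gamma> t \<in> ball 0 1" for t using \<rho> by (simp add: \<gamma>_def norm_mult)
  have \<gamma>s: "\<gamma> s = w" unfolding \<gamma>_def s_def \<rho>_def by (metis rcis_cmod_Arg rcis_def)
  have \<gamma>_per: "\<gamma> (t + 2 * pi) = \<gamma> t" for t by (simp add: \<gamma>_def cis.code)
  \<comment> \<open>\<open>z\<close> is reached from \<open>w\<close> by a rotation through an angle
    in [0, 2 pi), which is nonzero because \<open>z \<noteq> w\<close>.\<close>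
  obtain t where t: "s < t" "t < s + 2 * pi" "\<gamma> t = z"
  proof
    let ?a = "Arg2pi (z / w)"
    have nzw: "norm (z / w) = 1" using z w by (simp add: norm_divide)
    have "z / w = cis ?a"
      using Arg2pi_eq[of "z / w"] nzw by (simp add: cis_conv_exp)
    then have "z = w * cis ?a" using w by (simp add: field_simps)
    also have "\<dots> = \<gamma> (s + ?a)" by (subst \<gamma>s[symmetric]) (simp add: \<gamma>_def cis_mult)
    finally show "\<gamma> (s + ?a) = z" ..
    have "?a \<noteq> 0" using \<open>z = w * cis ?a\<close> z by auto
    then show "s < s + ?a" "s + ?a < s + 2 * pi"
      using Arg2pi_ge_0[of "z / w"] Arg2pi_lt_2pi[of "z / w"] by auto
  qed
  have d\<gamma>: "(\<gamma> has_vector_derivative \<i> * \<gamma> x) (at x)" for x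
    unfolding \<gamma>_def cis_conv_exp
    by (rule has_vector_derivative_real_field) (auto intro!: derivative_eq_intros)
  have dL: "deriv L x = deriv (deriv h) x / deriv h x" if "x \<in> ball 0 1" for x
  proof -
    have "((\<lambda>z. exp (L z)) has_field_derivative exp (L x) * deriv L x) (at x)"
      using that L(1) by (intro DERIV_fun_exp) (auto intro: holomorphic_derivI)
    then have "(deriv h has_field_derivative exp (L x) * deriv L x) (at x)"
      by (rule has_field_derivative_transform_within_open[OF _ open_ball that]) (use L(2) in auto)
    then show ?thesis using L(2)[OF that] nz[OF that] by (auto dest: DERIV_imp_deriv)
  qed
  \<comment> \<open>The speed of turning is exactly the expression assumed positive.\<close>
  have d\<psi>: "(\<psi> has_real_derivative Re (1 + \<gamma> x * deriv (deriv h) (\<gamma> x) / deriv h (\<gamma> x))) (at x)" for x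
  proof -
    have "(L has_field_derivative deriv L (\<gamma> x)) (at (\<gamma> x))"
      using L(1) \<gamma>_in by (auto intro: holomorphic_derivI)
    then have "(L \<circ> \<gamma> has_vector_derivative \<i> * \<gamma> x * deriv L (\<gamma> x)) (at x)"
      by (rule field_vector_diff_chain_at[OF d\<gamma>])
    then have "((\<lambda>x. Im ((L \<circ> \<gamma>) x)) has_vector_derivative Im (\<i> * \<gamma> x * deriv L (\<gamma> x))) (at x)"
      by (rule bounded_linear.has_vector_derivative[OF bounded_linear_Im])
    then have "((\<lambda>x. Im (L (\<gamma> x))) has_real_derivative Re (\<gamma> x * deriv L (\<gamma> x))) (at x)"
      by (simp add: has_real_derivative_iff_has_vector_derivative mult.assoc)
    then show ?thesis unfolding \<psi>_def dL[OF \<gamma>_in]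
      by (simp add: DERIV_add[OF DERIV_ident])
  qed
  have polar: "\<gamma> x * deriv h (\<gamma> x) = of_real (\<rho> * exp (Re (L (\<gamma> x)))) * cis (\<psi> x)" for x
  proof -
    have "deriv h (\<gamma> x) = of_real (exp (Re (L (\<gamma> x)))) * cis (Im (L (\<gamma> x)))"
      by (simp add: L(2)[OF \<gamma>_in, symmetric] exp_eq_polar exp_of_real)
    then show ?thesis by (simp add: \<gamma>_def \<psi>_def cis_mult[symmetric] mult_ac)
  qed
  have du: "(u has_real_derivative exp (Re (L (\<gamma> x))) / exp (Re (L w)) * sin (\<psi> x - \<psi> s)) (at x)" for x
  proof -
    have "(h has_field_derivative deriv h (\<gamma> x)) (at (\<gamma> x))"
      using holh \<gamma>_in by (auto intro: holomorphic_derivI)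
    then have "(h \<circ> \<gamma> has_vector_derivative \<i> * \<gamma> x * deriv h (\<gamma> x)) (at x)"
      by (rule field_vector_diff_chain_at[OF d\<gamma>])
    then have "((\<lambda>x. (h w - h (\<gamma> x)) / (w * deriv h w)) has_vector_derivative
        (0 - \<i> * \<gamma> x * deriv h (\<gamma> x)) / (w * deriv h w)) (at x)"
      unfolding o_def divide_inverse
      by (intro has_vector_derivative_mult_left has_vector_derivative_diff has_vector_derivative_const)
    then have "(u has_vector_derivative Re ((0 - \<i> * \<gamma> x * deriv h (\<gamma> x)) / (w * deriv h w))) (at x)"
      unfolding u_def by (rule bounded_linear.has_vector_derivative[OF bounded_linear_Re])
    moreover have "(0 - \<i> * \<gamma> x * deriv h (\<gamma> x)) / (w * deriv h w) =
        - \<i> * (of_real (exp (Re (L (\<gamma> x))) / exp (Re (L w))) * cis (\<psi> x - \<psi> s))"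
      using polar[of x] polar[of s] \<rho>
      by (simp add: \<gamma>s cis_divide[symmetric] mult.assoc)
    ultimately show ?thesis
      by (simp add: has_real_derivative_iff_has_vector_derivative)
  qed
  have incr: "\<psi> a < \<psi> b" if "a < b" for a b
    by (rule DERIV_pos_imp_increasing[OF that]) (use d\<psi> cvx[OF \<gamma>_in] in \<open>iprover intro: exI conjI\<close>)
  \<comment> \<open>\<open>L\<close> is single-valued on the disc, so only the summand
    \<open>t\<close> contributes to the total turning.\<close>
  have \<psi>_per: "\<psi> (s + 2 * pi) = \<psi> s + 2 * pi" by (simp add: \<psi>_def \<gamma>_per)
  have u0: "u s = 0" "u (s + 2 * pi) = 0" using \<gamma>_per[of s] by (auto simp: u_def \<gamma>s)
  have contu: "continuous_on A u" for A
    by (rule DERIV_continuous_on[OF has_field_derivative_at_within[OF du]])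
  have "0 < u t"
  \<comment> \<open>Up to a turn of pi, \<open>u\<close> has risen from its zero at
    \<open>s\<close>; after that it still has to fall to its zero at
    \<open>s + 2 * pi\<close>.\<close>
  proof (cases "\<psi> t - \<psi> s \<le> pi")
    case True
    have "u s < u t"
    proof (rule DERIV_pos_imp_increasing_open[OF \<open>s < t\<close> _ contu])
      fix x assume "s < x" "x < t"
      then have "0 < sin (\<psi> x - \<psi> s)"
        using incr[of s x] incr[of x t] True by (intro sin_gt_zero) auto
      then show "\<exists>y. (u has_real_derivative y) (at x) \<and> 0 < y"
        by (intro exI[of _ "exp (Re (L (\<gamma> x))) / exp (Re (L w)) * sin (\<psi> x - \<psi> s)"] conjI du) simp
    qed
    then show ?thesis by (simp add: u0)
  next
    case False
    have "u (s + 2 * pi) < u t"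
    proof (rule DERIV_neg_imp_decreasing_open[OF \<open>t < s + 2 * pi\<close> _ contu])
      fix x assume "t < x" "x < s + 2 * pi"
      then have "sin (\<psi> x - \<psi> s) < 0"
        using incr[of t x] incr[of x "s + 2 * pi"] False \<psi>_per by (intro sin_lt_zero) auto
      then show "\<exists>y. (u has_real_derivative y) (at x) \<and> y < 0"
        by (intro exI[of _ "exp (Re (L (\<gamma> x))) / exp (Re (L w)) * sin (\<psi> x - \<psi> s)"] conjI du)
          (simp add: mult_less_0_iff divide_less_0_iff)
    qed
    then show ?thesis by (simp add: u0)
  qed
  then show ?thesis by (simp add: u_def t)
qed

text \<open>The circle case gives a real part at most 0 for \<open>F\<close> on the boundary. The
  maximum principle carries this inside, and openness of \<open>F\<close> makes it strict.\<close>

lemma convex_function_support: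
  assumes holh: "h holomorphic_on ball 0 1"
    and nz: "\<And>z. z \<in> ball 0 1 \<Longrightarrow> deriv h z \<noteq> 0"
    and cvx: "\<And>z. z \<in> ball 0 1 \<Longrightarrow> 0 < Re (1 + z * deriv (deriv h) z / deriv h z)"
    and w: "norm w < 1" and z: "norm z \<le> norm w" "z \<noteq> w"
  shows "0 < Re ((h w - h z) / (w * deriv h w))"
proof (cases "norm z = norm w")
  case True
  have "w \<noteq> 0" using z by auto
  then show ?thesis using convex_function_support_circle[OF holh nz cvx _ w True] z by auto
next
  case False
  then have less: "norm z < norm w" using z by simp
  then have w0: "w \<noteq> 0" by auto
  define c where "c = w * deriv h w"
  have c: "c \<noteq> 0" using nz[of w] w w0 by (auto simp: c_def)
  define F where "F = (\<lambda>x. (h x - h w) / c)"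
  have sub: "cball 0 (norm w) \<subseteq> ball 0 1" using w by (simp add: subset_iff)
  have holF: "F holomorphic_on ball 0 1"
    unfolding F_def using holh c by (intro holomorphic_intros)
  have bd: "Re (F x) \<le> 0" if "x \<in> ball 0 (norm w)" for x
  proof (rule maximum_real_frontier[of F "ball 0 (norm w)" 0])
    show "F holomorphic_on interior (ball 0 (norm w))"
      using holF w by (auto intro!: holomorphic_on_subset[OF holF])
    show "continuous_on (closure (ball 0 (norm w))) F"
      using holF sub w0 by (auto intro: holomorphic_on_imp_continuous_on continuous_on_subset)
    fix y :: complex assume "y \<in> frontier (ball 0 (norm w))"
    then have "norm y = norm w" using w0 by (simp add: frontier_ball)
    then show "Re (F y) \<le> 0"
      using convex_function_support_circle[OF holh nz cvx w0 w, of y]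
      by (cases "y = w") (auto simp: F_def c_def diff_divide_distrib)
  qed (use that in auto)
  \<comment> \<open>A whole disc around \<open>F z\<close> lies in the image, including a point
    further to the right by \<open>e / 2\<close>. Its real part is still at most 0, so that of
    \<open>F z\<close> is negative.\<close>
  have "open (F ` ball 0 (norm w))"
  proof (rule open_mapping_thm[of F "ball 0 1"])
    show "\<not> F constant_on ball 0 1"
    proof
      assume "F constant_on ball 0 1"
      then obtain k where "\<And>x. x \<in> ball 0 1 \<Longrightarrow> F x = k" by (auto simp: constant_on_def)
      then have "(F has_field_derivative 0) (at 0)"
        by (intro has_field_derivative_transform_within_open[OF DERIV_const[of k] open_ball[of 0 1]]) auto
      moreover have "(F has_field_derivative deriv h 0 / c) (at 0)"
        unfolding F_def using holomorphic_derivI[OF holh open_ball, of 0] c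
        by (auto intro!: derivative_eq_intros)
      ultimately have "deriv h 0 / c = 0" by (rule DERIV_unique[symmetric])
      then show False using c nz[of 0] by simp
    qed
  qed (use holF sub in \<open>auto intro: ball_subset_cball[THEN subset_trans]\<close>)
  then obtain e where e: "e > 0" "ball (F z) e \<subseteq> F ` ball 0 (norm w)"
    using less by (meson imageI mem_ball_0 open_contains_ball)
  have "F z + of_real (e / 2) \<in> ball (F z) e" using e by (simp add: dist_norm)
  then obtain x where "x \<in> ball 0 (norm w)" "F x = F z + of_real (e / 2)"
    using e by (metis (no_types, lifting) imageE subsetD)
  then have "Re (F z) + e / 2 \<le> 0" using bd[of x] by simp
  then show ?thesis using e by (simp add: F_def c_def diff_divide_distrib)
qed

text \<open>At whichever of two points has the larger modulus, the support inequality excludes equal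
  values.\<close>

lemma convex_function_inj:
  assumes holh: "h holomorphic_on ball 0 1"
    and nz: "\<And>z. z \<in> ball 0 1 \<Longrightarrow> deriv h z \<noteq> 0"
    and cvx: "\<And>z. z \<in> ball 0 1 \<Longrightarrow> 0 < Re (1 + z * deriv (deriv h) z / deriv h z)"
  shows "inj_on h (ball 0 1)"
proof (rule inj_onI, rule ccontr)
  fix z w assume *: "z \<in> ball 0 1" "w \<in> ball 0 1" "h z = h w" "z \<noteq> w"
  then show False
    using convex_function_support[OF holh nz cvx, of w z] convex_function_support[OF holh nz cvx, of z w]
    by (cases "norm z \<le> norm w") auto
qed

text \<open>Suppose a chord of \<open>K\<close> contains a point \<open>x\<close> outside
  \<open>K\<close>. The segment from \<open>h 0\<close> to \<open>x\<close> meets the frontier of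
  \<open>K\<close> at some \<open>p\<close>. The support functional at \<open>p\<close> is
  nonnegative at the ends of the chord, hence at \<open>x\<close>, and positive at
  \<open>h 0\<close>. Being affine, it would be positive at \<open>p\<close>, where it is
  zero.\<close>

lemma convex_function_image:
  assumes holh: "h holomorphic_on ball 0 1"
    and nz: "\<And>z. z \<in> ball 0 1 \<Longrightarrow> deriv h z \<noteq> 0"
    and cvx: "\<And>z. z \<in> ball 0 1 \<Longrightarrow> 0 < Re (1 + z * deriv (deriv h) z / deriv h z)"
    and r: "0 < r" "r < 1"
  shows "convex (h ` cball 0 r)"
proof -
  define K where "K = h ` cball 0 r"
  have "compact K" unfolding K_def
    using holh r by (intro compact_continuous_image)
      (auto intro!: holomorphic_on_imp_continuous_on holomorphic_on_subset[OF holh])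
  then have clK: "closed K" by (rule compact_imp_closed)
  have injh: "inj_on h (ball 0 1)" by (rule convex_function_inj[OF holh nz cvx])
  have "open (h ` ball 0 r)"
    using r by (intro open_mapping_thm3 holomorphic_on_subset[OF holh] inj_on_subset[OF injh]) auto
  then have int: "h ` ball 0 r \<subseteq> interior K"
    unfolding K_def by (intro interior_maximal image_mono) auto
  have False if ab: "a \<in> K" "b \<in> K" and x: "x \<in> closed_segment a b" "x \<notin> K" for a b x
  proof -
    have "h 0 \<in> K" using r by (auto simp: K_def)
    then have "closed_segment (h 0) x \<inter> frontier K \<noteq> {}"
      using x by (intro connected_Int_frontier) auto
    then obtain p where p: "p \<in> closed_segment (h 0) x" "p \<in> frontier K" by auto
    have "p \<in> K" using p(2) clK by (simp add: frontier_def)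
    then obtain w where w: "norm w \<le> r" "p = h w" by (auto simp: K_def)
    \<comment> \<open>Frontier points come only from the bounding circle, as the open disc has open
      image. This is what makes the support inequality at \<open>w\<close> available for all of
      \<open>K\<close>.\<close>
    have "norm w = r"
    proof (rule ccontr)
      assume "norm w \<noteq> r"
      then have "p \<in> interior K" using w int by (simp add: image_subset_iff)
      then show False using p(2) by (simp add: frontier_def)
    qed
    define N where "N = (\<lambda>y. Re ((p - y) / (w * deriv h w)))"
    have sup: "0 < N (h z)" if "norm z \<le> r" "z \<noteq> w" for z
      using convex_function_support[OF holh nz cvx, of w z] that \<open>norm w = r\<close> r w by (simp add: N_def)
    have N0: "0 < N (h 0)" using sup[of 0] r \<open>norm w = r\<close> by auto
    have NK: "0 \<le> N y" if "y \<in> K" for y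
      using that sup by (force simp: K_def N_def w)
    have aff: "N ((1 - t) *\<^sub>R y + t *\<^sub>R y') = (1 - t) * N y + t * N y'" for t y y'
    proof -
      have "(p - ((1 - t) *\<^sub>R y + t *\<^sub>R y')) / (w * deriv h w) =
        of_real (1 - t) * ((p - y) / (w * deriv h w)) + of_real t * ((p - y') / (w * deriv h w))"
        by (simp add: scaleR_conv_of_real add_divide_distrib[symmetric] algebra_simps)
      then show ?thesis unfolding N_def by (simp only: plus_complex.sel scaleR_conv_of_real[symmetric] scaleR_complex.sel)
    qed
    obtain t where t: "x = (1 - t) *\<^sub>R a + t *\<^sub>R b" "0 \<le> t" "t \<le> 1"
      using x(1) by (auto simp: in_segment)
    have Nx: "0 \<le> N x" unfolding t(1) aff using t NK ab by (intro add_nonneg_nonneg mult_nonneg_nonneg) auto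
    obtain t' where t': "p = (1 - t') *\<^sub>R h 0 + t' *\<^sub>R x" "0 \<le> t'" "t' \<le> 1"
      using p(1) by (auto simp: in_segment)
    \<comment> \<open>Since \<open>p\<close> is in \<open>K\<close> and \<open>x\<close> is not,
      \<open>h 0\<close> enters the combination with positive weight.\<close>
    have "t' \<noteq> 1" using t'(1) \<open>p \<in> K\<close> x by auto
    then have "0 < (1 - t') * N (h 0) + t' * N x"
      using t' N0 Nx by (intro add_pos_nonneg mult_pos_pos mult_nonneg_nonneg) auto
    also have "\<dots> = N p" by (simp only: aff[symmetric] t'(1)[symmetric])
    finally show False by (simp add: N_def)
  qed
  then show ?thesis unfolding K_def[symmetric] convex_contains_segment by blast
qed

text \<open>Equal values of h + cnj g at two points force the increments of \<open>h\<close> and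
  \<open>g\<close> to have equal modulus. This contradicts the contraction factor
  \<open>k < 1\<close> unless both increments vanish, and then injectivity of \<open>h\<close>
  applies.\<close>

lemma harmonic_inj_of_convex_part:
  assumes holh: "h holomorphic_on ball 0 1" and holg: "g holomorphic_on ball 0 1"
    and nz: "\<And>z. z \<in> ball 0 1 \<Longrightarrow> deriv h z \<noteq> 0"
    and cvx: "\<And>z. z \<in> ball 0 1 \<Longrightarrow> 0 < Re (1 + z * deriv (deriv h) z / deriv h z)"
    and dil: "\<And>z. z \<in> cball 0 r \<Longrightarrow> norm (deriv g z) \<le> k * norm (deriv h z)"
    and k: "k < 1" and r: "0 < r" "r < 1"
  shows "inj_on (\<lambda>z. h z + cnj (g z)) (cball 0 r)"
proof -
  have injh: "inj_on h (ball 0 1)" by (rule convex_function_inj[OF holh nz cvx])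
  obtain q where q: "q holomorphic_on (h ` ball 0 1)"
    "\<And>z. z \<in> ball 0 1 \<Longrightarrow> deriv h z * deriv q (h z) = 1" "\<And>z. z \<in> ball 0 1 \<Longrightarrow> q (h z) = z"
    using holomorphic_has_inverse[OF holh open_ball injh] by blast
  have op: "open (h ` ball 0 1)" by (rule open_mapping_thm3[OF holh open_ball injh])
  have sub: "cball 0 r \<subseteq> ball (0::complex) 1" using r by auto
  have lip: "norm (g z - g w) \<le> k * norm (h z - h w)" if "z \<in> cball 0 r" "w \<in> cball 0 r" for z w
  proof -
    \<comment> \<open>The mean value bound is applied to g after the inverse \<open>q\<close> of
      \<open>h\<close>, whose derivative is g'/h'. It needs a convex domain, which is why convexity
      of the image disc was proved.\<close>
    have "norm ((g \<circ> q) (h z) - (g \<circ> q) (h w)) \<le> k * norm (h z - h w)"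
    proof (rule field_differentiable_bound)
      show "convex (h ` cball 0 r)" using convex_function_image[OF holh nz cvx r] by blast
      fix y assume "y \<in> h ` cball 0 r"
      then obtain x where x: "x \<in> cball 0 r" "y = h x" by auto
      then have x1: "x \<in> ball 0 1" using sub by auto
      then have qy: "q y = x" using q(3) x(2) by simp
      have "(g has_field_derivative deriv g (q y)) (at (q y))"
        using holomorphic_derivI[OF holg open_ball x1] by (simp add: qy)
      moreover have "(q has_field_derivative deriv q y) (at y)"
        using holomorphic_derivI[OF q(1) op] x x1 by simp
      ultimately show "(g \<circ> q has_field_derivative deriv g (q y) * deriv q y) (at y within h ` cball 0 r)"
        by (rule has_field_derivative_at_within[OF DERIV_chain])
      have "norm (deriv g (q y) * deriv q y) \<le> k * norm (deriv h x) * norm (deriv q y)"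
        unfolding qy norm_mult by (intro mult_right_mono dil x) simp
      also have "\<dots> = k * norm (deriv h x * deriv q (h x))" by (simp add: norm_mult x)
      finally show "norm (deriv g (q y) * deriv q y) \<le> k" using q(2)[OF x1] by simp
    qed (use that in auto)
    then show ?thesis using q(3)[of z] q(3)[of w] that r by simp
  qed
  show ?thesis
  proof (rule inj_onI)
    fix z w assume zw: "z \<in> cball 0 r" "w \<in> cball 0 r" "h z + cnj (g z) = h w + cnj (g w)"
    then have "h z - h w = - cnj (g z - g w)" by (simp add: algebra_simps)
    then have "norm (h z - h w) = norm (g z - g w)" by (metis complex_mod_cnj norm_minus_cancel)
    then have "(1 - k) * norm (h z - h w) \<le> 0" using lip[OF zw(1,2)] by (simp add: algebra_simps)
    then have "h z = h w" using k by (simp add: mult_le_0_iff)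
    then show "z = w" using inj_onD[OF injh, of z w] zw r by simp
  qed
qed

section \<open>Distortion\<close>

text \<open>The function z h''/h' vanishes at 0 and takes values in the half-plane Re v > -b with b
  = 1 - \<alpha>. The map v / (v + 2b) sends this half-plane to the unit disc and fixes 0, so the
  Schwarz lemma applies. Inverting the map gives W = 2b \<omega> / (1 - \<omega>) with |\<omega>| at
  most |z|.\<close>

lemma convex_order_log_derivative_bounds:
  fixes h :: "complex \<Rightarrow> complex" and \<alpha> :: real
  assumes holh: "h holomorphic_on ball 0 1"
    and nz: "\<And>z. z \<in> ball 0 1 \<Longrightarrow> deriv h z \<noteq> 0"
    and cvx: "\<And>z. z \<in> ball 0 1 \<Longrightarrow> \<alpha> < Re (1 + z * deriv (deriv h) z / deriv h z)"
    and \<alpha>: "\<alpha> < 1" and z: "norm z < 1"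
  defines "W \<equiv> z * deriv (deriv h) z / deriv h z"
  shows "- (2 * (1 - \<alpha>) * norm z / (1 + norm z)) \<le> Re W"
    and "Re W \<le> 2 * (1 - \<alpha>) * norm z / (1 - norm z)"
proof -
  define b where "b = 1 - \<alpha>"
  have b: "b > 0" using \<alpha> by (simp add: b_def)
  have holh': "deriv h holomorphic_on ball 0 1" using holh by (intro holomorphic_deriv) auto
  have holh'': "deriv (deriv h) holomorphic_on ball 0 1" using holh' by (rule holomorphic_deriv) simp
  define V where "V = (\<lambda>z. z * deriv (deriv h) z / deriv h z)"
  have V: "- b < Re (V x)" if "x \<in> ball 0 1" for x
    using cvx[OF that] by (simp add: V_def b_def)
  have holV: "V holomorphic_on ball 0 1"
    unfolding V_def using nz by (intro holomorphic_intros holh' holh'') auto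
  define w where "w = (\<lambda>z. V z / (V z + of_real (2 * b)))"
  have V0: "V x + of_real (2 * b) \<noteq> 0" if "x \<in> ball 0 1" for x
    using V[OF that] b by (auto simp: complex_eq_iff)
  have "norm (w z) \<le> norm z"
  proof (rule Schwarz_Lemma(1))
    show "w holomorphic_on ball 0 1"
      unfolding w_def using V0 by (intro holomorphic_intros holV) auto
    show "w 0 = 0" by (simp add: w_def V_def)
    fix x :: complex assume "norm x < 1"
    then have x: "x \<in> ball 0 1" by simp
    \<comment> \<open>The line Re v = -b is the perpendicular bisector of 0 and -2b, so
      \<open>V x\<close> is closer to 0.\<close>
    have "(norm (V x))\<^sup>2 < (norm (V x + of_real (2 * b)))\<^sup>2"
    proof -
      have "(norm (V x + of_real (2 * b)))\<^sup>2 - (norm (V x))\<^sup>2 = 4 * b * (Re (V x) + b)"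
        unfolding cmod_power2 by (simp add: power2_eq_square algebra_simps)
      moreover have "0 < 4 * b * (Re (V x) + b)" using V[OF x] b by simp
      ultimately show ?thesis by linarith
    qed
    then have "norm (V x) < norm (V x + of_real (2 * b))"
      by (rule power_less_imp_less_base) simp
    then show "norm (w x) < 1"
      using V0[OF x] by (simp add: w_def norm_divide)
  qed (use z in auto)
  define \<omega> where "\<omega> = w z"
  have \<omega>: "norm \<omega> \<le> norm z" "norm \<omega> < 1" using \<open>norm (w z) \<le> norm z\<close> z by (auto simp: \<omega>_def)
  then have \<omega>1: "1 - \<omega> \<noteq> 0" by auto
  have "V z * (1 - \<omega>) = of_real (2 * b) * \<omega>"
    using V0[of z] z unfolding \<omega>_def w_def by (simp add: field_simps)
  then have VW: "W = of_real (2 * b) * (\<omega> / (1 - \<omega>))"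
    using \<omega>1 by (simp add: W_def V_def field_simps)
  have "Re W = 2 * b * Re (\<omega> / (1 - \<omega>))" unfolding VW by (simp only: Re_complex_of_real scaleR_conv_of_real[symmetric] scaleR_complex.sel)
  moreover have "Re (\<omega> / (1 - \<omega>)) \<le> norm z / (1 - norm z)"
  proof -
    have "Re (\<omega> / (1 - \<omega>)) \<le> norm (\<omega> / (1 - \<omega>))" by (rule complex_Re_le_cmod)
    also have "\<dots> \<le> norm z / (1 - norm z)"
      unfolding norm_divide using \<omega> z norm_triangle_ineq2[of 1 \<omega>]
      by (intro frac_le) auto
    finally show ?thesis .
  qed
  moreover have "- (norm z / (1 + norm z)) \<le> Re (\<omega> / (1 - \<omega>))"
  proof -
    have "\<omega> / (1 - \<omega>) = 1 / (1 - \<omega>) - 1" using \<omega>1 by (simp add: field_simps)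
    then have "Re (\<omega> / (1 - \<omega>)) = Re (1 / (1 - \<omega>)) - 1" by simp
    \<comment> \<open>The extremal case is \<omega> = -|z|. After clearing denominators and using
      |\<omega>| at most |z|, the claim becomes the nonnegativity of (1 - |z|)(|z| + x).\<close>
    moreover have "1 / (1 + norm z) \<le> Re (1 / (1 - \<omega>))"
    proof -
      define x y where "x = Re \<omega>" and "y = Im \<omega>"
      have \<omega>sq: "x\<^sup>2 + y\<^sup>2 \<le> (norm z)\<^sup>2" "\<bar>x\<bar> \<le> norm z"
        using power_mono[OF \<omega>(1), of 2] abs_Re_le_cmod[of \<omega>] \<omega>(1) by (auto simp: cmod_power2 x_def y_def)
      have pos: "0 < (1 - x)\<^sup>2 + y\<^sup>2" using \<omega>1 \<omega>sq z by (intro add_pos_nonneg) auto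
      have "Re (1 / (1 - \<omega>)) = (1 - x) / ((1 - x)\<^sup>2 + y\<^sup>2)"
        by (simp add: Re_divide x_def y_def)
      moreover have "(1 - x)\<^sup>2 + y\<^sup>2 \<le> (1 - x) * (1 + norm z)"
      proof -
        have "0 \<le> (1 - norm z) * (norm z + x)" using \<omega>sq(2) z by (intro mult_nonneg_nonneg) auto
        then show ?thesis using \<omega>sq(1) by (simp add: power2_eq_square algebra_simps)
      qed
      ultimately show ?thesis using pos
        by (simp add: pos_le_divide_eq pos_divide_le_eq add_pos_nonneg del: add.commute)
    qed
    moreover have "1 / (1 + norm z) - 1 = - (norm z / (1 + norm z))"
      by (simp add: field_simps add_nonneg_eq_0_iff)
    ultimately show ?thesis by linarith
  qed
  ultimately have "2 * b * - (norm z / (1 + norm z)) \<le> Re W" "Re W \<le> 2 * b * (norm z / (1 - norm z))"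
    using b by (auto simp only: intro!: mult_left_mono)
  then have "- (2 * b * (norm z / (1 + norm z))) \<le> Re W" "Re W \<le> 2 * b * (norm z / (1 - norm z))"
    by simp_all
  then show "- (2 * (1 - \<alpha>) * norm z / (1 + norm z)) \<le> Re W"
    and "Re W \<le> 2 * (1 - \<alpha>) * norm z / (1 - norm z)"
    by (simp_all add: b_def)
qed

text \<open>Along the radius to \<open>z\<close>, the preceding bounds say that log |h'| grows at a
  rate between -b/(1+t) and b/(1-t), where b = 2(1 - \<alpha>). It starts from 0 because
  \<open>deriv h 0 = 1\<close>.\<close>

lemma convex_order_distortion:
  fixes h :: "complex \<Rightarrow> complex" and \<alpha> :: real
  assumes holh: "h holomorphic_on ball 0 1" and h'0: "deriv h 0 = 1"
    and nz: "\<And>z. z \<in> ball 0 1 \<Longrightarrow> deriv h z \<noteq> 0"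
    and cvx: "\<And>z. z \<in> ball 0 1 \<Longrightarrow> \<alpha> < Re (1 + z * deriv (deriv h) z / deriv h z)"
    and \<alpha>: "\<alpha> < 1" and z: "norm z < 1"
  shows "(1 + norm z) powr (- 2 * (1 - \<alpha>)) \<le> norm (deriv h z)"
    and "norm (deriv h z) \<le> (1 - norm z) powr (- 2 * (1 - \<alpha>))"
proof -
  define b where "b = 2 * (1 - \<alpha>)"
  \<comment> \<open>For \<open>z = 0\<close> the direction \<open>e\<close> is 0 rather than a unit
    vector, hence only \<open>norm e \<le> 1\<close> is claimed next.\<close>
  define e where "e = sgn z"
  define \<rho> where "\<rho> = norm z"
  have holh': "deriv h holomorphic_on ball 0 1" using holh by (intro holomorphic_deriv) auto
  have ne: "norm e \<le> 1" by (simp add: e_def norm_sgn)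
  have ez: "of_real \<rho> * e = z" by (simp add: e_def \<rho>_def sgn_eq)
  have \<rho>: "0 \<le> \<rho>" "\<rho> < 1" using z by (auto simp: \<rho>_def)
  define l where "l = (\<lambda>t. ln (norm (deriv h (of_real t * e))))"
  have in_ball: "of_real t * e \<in> ball 0 1" if "0 \<le> t" "t \<le> \<rho>" for t
  proof -
    have "\<bar>t\<bar> * norm e \<le> \<rho> * 1" using that ne by (intro mult_mono) auto
    then show ?thesis using \<rho> by (simp add: norm_mult)
  qed
  define D where "D = (\<lambda>t. Re (e * deriv (deriv h) (of_real t * e) / deriv h (of_real t * e)))"
  have dl: "(l has_real_derivative D t) (at t)" if "0 \<le> t" "t \<le> \<rho>" for t
  proof -
    let ?x = "of_real t * e"
    have nz': "deriv h ?x \<noteq> 0" using nz in_ball[OF that] by blast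
    have "((\<lambda>t. of_real t * e) has_vector_derivative e) (at t)"
      using has_vector_derivative_mult_left[OF has_vector_derivative_of_real[OF DERIV_ident], where a = e] by simp
    moreover have "(deriv h has_field_derivative deriv (deriv h) ?x) (at ?x)"
      using holh' in_ball[OF that] by (auto intro: holomorphic_derivI)
    ultimately have "(deriv h \<circ> (\<lambda>t. of_real t * e) has_vector_derivative e * deriv (deriv h) ?x) (at t)"
      by (rule field_vector_diff_chain_at)
    then have "((\<lambda>t. deriv h (of_real t * e)) has_derivative (\<lambda>s. s *\<^sub>R (e * deriv (deriv h) ?x))) (at t)"
      by (simp add: o_def has_vector_derivative_def)
    then have "((\<lambda>t. norm (deriv h (of_real t * e))) has_derivative
        (\<lambda>s. (s *\<^sub>R (e * deriv (deriv h) ?x)) \<bullet> sgn (deriv h ?x))) (at t)"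
      by (rule has_derivative_compose) (rule has_derivative_norm[OF nz'])
    then have "((\<lambda>t. norm (deriv h (of_real t * e))) has_real_derivative
        (e * deriv (deriv h) ?x) \<bullet> sgn (deriv h ?x)) (at t)"
      by (simp add: has_field_derivative_def mult_commute_abs)
    then have "(l has_real_derivative
        inverse (norm (deriv h ?x)) * ((e * deriv (deriv h) ?x) \<bullet> sgn (deriv h ?x))) (at t)"
      unfolding l_def using nz' by (intro DERIV_ln[THEN DERIV_chain2]) auto
    moreover have "inverse (norm (deriv h ?x)) * ((e * deriv (deriv h) ?x) \<bullet> sgn (deriv h ?x)) = D t"
    proof -
      \<comment> \<open>The derivative of the norm is an inner product with \<open>sgn\<close>;
        dividing by the norm turns it into the real part of the logarithmic derivative.\<close>
      have "inverse (norm q) * (p \<bullet> sgn q) = Re (p / q)" for p q :: complex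
      proof -
        have "Re (p / q) = (p \<bullet> q) / (norm q)\<^sup>2"
          by (simp add: Re_divide cmod_power2 inner_complex_def)
        then show ?thesis by (simp add: sgn_div_norm power2_eq_square divide_inverse)
      qed
      then show ?thesis by (simp add: D_def)
    qed
    ultimately show ?thesis by simp
  qed
  \<comment> \<open>The earlier bounds concern \<open>t * D t\<close>, so \<open>t\<close> must be
    positive to divide by it. The open interval suffices for the monotonicity arguments
    below.\<close>
  have Db: "- b / (1 + t) \<le> D t" "D t \<le> b / (1 - t)" if "0 < t" "t < \<rho>" for t
  proof -
    have "z \<noteq> 0" using that \<rho>_def by auto
    then have "norm e = 1" by (simp add: e_def norm_sgn)
    then have nt: "norm (of_real t * e) = t" using that by (simp add: norm_mult)
    have "Re (of_real t * e * deriv (deriv h) (of_real t * e) / deriv h (of_real t * e)) = t * D t"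
    proof -
      have "of_real t * e * deriv (deriv h) (of_real t * e) / deriv h (of_real t * e)
          = of_real t * (e * deriv (deriv h) (of_real t * e) / deriv h (of_real t * e))" by simp
      then show ?thesis
        unfolding D_def by (simp only: times_complex.sel Re_complex_of_real Im_complex_of_real mult_zero_left diff_zero)
    qed
    then have "- (b * t / (1 + t)) \<le> t * D t" "t * D t \<le> b * t / (1 - t)"
      using convex_order_log_derivative_bounds[OF holh nz cvx \<alpha>, of "of_real t * e"] that \<rho>
      by (auto simp: nt b_def)
    then have "t * (- b / (1 + t)) \<le> t * D t" "t * D t \<le> t * (b / (1 - t))"
      by (auto simp: mult.commute)
    then show "- b / (1 + t) \<le> D t" "D t \<le> b / (1 - t)"
      using that mult_le_cancel_left_pos[of t] by blast+
  qed
  have l0: "l 0 = 0" by (simp add: l_def h'0)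
  have "l 0 + b * ln (1 + 0) \<le> l \<rho> + b * ln (1 + \<rho>)"
  proof (rule DERIV_nonneg_imp_increasing_open[OF \<rho>(1)])
    fix t assume t: "0 < t" "t < \<rho>"
    have "((\<lambda>t. l t + b * ln (1 + t)) has_real_derivative D t + b / (1 + t)) (at t)"
      using t dl[of t] by (auto intro!: derivative_eq_intros)
    then show "\<exists>y. ((\<lambda>t. l t + b * ln (1 + t)) has_real_derivative y) (at t) \<and> 0 \<le> y"
      using Db(1)[OF t] by (intro exI[of _ "D t + b / (1 + t)"] conjI) auto
  next
    have "continuous_on {0..\<rho>} l"
      by (rule DERIV_continuous_on[OF has_field_derivative_at_within[OF dl]]) auto
    then show "continuous_on {0..\<rho>} (\<lambda>t. l t + b * ln (1 + t))"
      by (auto intro!: continuous_intros)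
  qed
  then have lower: "- b * ln (1 + \<rho>) \<le> l \<rho>" by (simp add: l0)
  have "l \<rho> + b * ln (1 - \<rho>) \<le> l 0 + b * ln (1 - 0)"
  proof (rule DERIV_nonpos_imp_decreasing_open[OF \<rho>(1)])
    fix t assume t: "0 < t" "t < \<rho>"
    have "((\<lambda>t. l t + b * ln (1 - t)) has_real_derivative D t - b / (1 - t)) (at t)"
      using t \<rho> dl[of t] by (auto intro!: derivative_eq_intros)
    then show "\<exists>y. ((\<lambda>t. l t + b * ln (1 - t)) has_real_derivative y) (at t) \<and> y \<le> 0"
      using Db(2)[OF t] by (intro exI[of _ "D t - b / (1 - t)"] conjI) auto
  next
    have "continuous_on {0..\<rho>} l"
      by (rule DERIV_continuous_on[OF has_field_derivative_at_within[OF dl]]) auto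
    then show "continuous_on {0..\<rho>} (\<lambda>t. l t + b * ln (1 - t))"
      using \<rho> by (auto intro!: continuous_intros)
  qed
  then have upper: "l \<rho> \<le> - b * ln (1 - \<rho>)" by (simp add: l0)
  have "norm (deriv h z) = exp (l \<rho>)" using nz[of z] z by (simp add: l_def ez)
  then show "(1 + norm z) powr (- 2 * (1 - \<alpha>)) \<le> norm (deriv h z)"
    and "norm (deriv h z) \<le> (1 - norm z) powr (- 2 * (1 - \<alpha>))"
    using lower upper \<rho> by (simp_all add: powr_def b_def \<rho>_def add_nonneg_eq_0_iff)
qed

section \<open>The area estimate\<close>

theorem theorem3p4:
  fixes h g :: "complex \<Rightarrow> complex" and \<alpha> r :: real and n :: nat and \<zeta> :: complex
  assumes "0 \<le> \<alpha>" "\<alpha> < 1"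
    and "norm \<zeta> \<le> 1 / (2 * real n - 1)"
    and "h holomorphic_on ball 0 1" "g holomorphic_on ball 0 1"
    and "h 0 = 0" "g 0 = 0" "deriv h 0 = 1"
    and "\<And>z. z \<in> ball 0 1 \<Longrightarrow> deriv h z \<noteq> 0"
    and "\<And>z. z \<in> ball 0 1 \<Longrightarrow> Re (1 + z * deriv (deriv h) z / deriv h z) > \<alpha>"
    and "\<And>z. z \<in> ball 0 1 \<Longrightarrow> deriv g z = \<zeta> * z ^ n * deriv h z"
    and "0 < r" "r < 1"
  shows "2 * pi * integral {0..r} (\<lambda>\<rho>. \<rho> * (1 - (norm \<zeta>)\<^sup>2 * \<rho> ^ (2 * n)) / (1 + \<rho>) powr (4 * (1 - \<alpha>)))
           \<le> measure lebesgue ((\<lambda>z. h z + cnj (g z)) ` ball 0 r)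
       \<and> measure lebesgue ((\<lambda>z. h z + cnj (g z)) ` ball 0 r)
           \<le> 2 * pi * integral {0..r} (\<lambda>\<rho>. \<rho> * (1 - (norm \<zeta>)\<^sup>2 * \<rho> ^ (2 * n)) / (1 - \<rho>) powr (4 * (1 - \<alpha>)))"
proof -
  note \<alpha> = assms(1,2) and holh = assms(4) and holg = assms(5) and h'0 = assms(8) and nz = assms(9)
    and cvx = assms(10) and g' = assms(11) and r = assms(12,13)
  \<comment> \<open>for \<open>n = 0\<close> the bound on \<open>norm \<zeta>\<close> is negative\<close>
  have "n \<noteq> 0"
    using assms(3) norm_ge_zero[of \<zeta>] by (cases "n = 0") (auto simp del: norm_ge_zero)
  then have "1 / (2 * real n - 1) \<le> 1" by (simp add: field_simps)
  then have \<zeta>: "norm \<zeta> \<le> 1" using assms(3) by linarith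
  have cvx0: "0 < Re (1 + z * deriv (deriv h) z / deriv h z)" if "z \<in> ball 0 1" for z
    using cvx[OF that] \<alpha> by linarith
  \<comment> \<open>The dilatation is at most \<open>k\<close> in modulus on the closed disc of
    radius \<open>r\<close>. Strictness \<open>k < 1\<close> comes from \<open>r < 1\<close> and
    \<open>n \<noteq> 0\<close>, even when |\<zeta>| = 1.\<close>
  define k where "k = norm \<zeta> * r ^ n"
  have "k \<le> 1 * r ^ n" unfolding k_def using \<zeta> r by (intro mult_right_mono) auto
  moreover have "r ^ n < 1" using r \<open>n \<noteq> 0\<close> by (simp add: power_less_one_iff)
  ultimately have k: "k < 1" by linarith
  have sub: "ball 0 r \<subseteq> ball (0::complex) 1" "cball 0 r \<subseteq> ball (0::complex) 1" using r by auto
  have dil: "norm (deriv g z) \<le> k * norm (deriv h z)" if "z \<in> cball 0 r" for z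
  proof -
    have "norm \<zeta> * norm z ^ n \<le> k"
      unfolding k_def using that by (intro mult_left_mono power_mono) auto
    moreover have "z \<in> ball 0 1" using that sub by auto
    ultimately show ?thesis using g' by (simp add: norm_mult norm_power mult_right_mono)
  qed
  define f where "f = (\<lambda>z. h z + cnj (g z))"
  have inj: "inj_on f (ball 0 r)"
    unfolding f_def
    using harmonic_inj_of_convex_part[OF holh holg nz cvx0 dil k r] by (rule inj_on_subset) auto
  define f' where "f' = (\<lambda>z v. deriv h z * v + cnj (deriv g z * v))"
  \<comment> \<open>This is the Jacobian of a harmonic map with analytic part \<open>h\<close> and
    co-analytic part \<open>g\<close>.\<close>
  define J where "J = (\<lambda>z. (norm (deriv h z))\<^sup>2 - (norm (deriv g z))\<^sup>2)"
  have J: "Re (f' z 1) * Im (f' z \<i>) - Im (f' z 1) * Re (f' z \<i>) = J z" for z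
    unfolding J_def f'_def cmod_power2 by (simp add: power2_eq_square algebra_simps)
  have contf: "continuous_on (ball 0 1) f"
    unfolding f_def using holh holg
    by (intro continuous_intros holomorphic_on_imp_continuous_on)
  have "compact (f ` cball 0 r)"
    using contf sub by (intro compact_continuous_image) (auto intro: continuous_on_subset)
  then have bdd: "bounded (f ` ball 0 r)"
    by (rule bounded_subset[OF compact_imp_bounded]) auto
  have "continuous_on (ball 0 1) (deriv h)" "continuous_on (ball 0 1) (deriv g)"
    using holh holg by (auto intro!: holomorphic_on_imp_continuous_on holomorphic_deriv)
  then have contJ: "continuous_on (ball 0 r) J"
    unfolding J_def using sub by (intro continuous_intros) (auto intro: continuous_on_subset)
  have "(f has_derivative f' z) (at z)" if "z \<in> ball 0 r" for z
  proof -
    have "z \<in> ball 0 1" using that sub by auto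
    then have "(h has_derivative (*) (deriv h z)) (at z)" "(g has_derivative (*) (deriv g z)) (at z)"
      using holh holg by (auto simp flip: has_field_derivative_def intro!: holomorphic_derivI)
    then show ?thesis unfolding f_def f'_def
      by (intro has_derivative_add bounded_linear.has_derivative[OF bounded_linear_cnj])
  qed
  then have area: "ennreal (measure lebesgue (f ` ball 0 r)) = (\<integral>\<^sup>+z\<in>ball 0 r. ennreal \<bar>J z\<bar> \<partial>lborel)"
    using measure_image_complex[of "ball 0 r" f f'] inj bdd contJ by (simp add: J)
  \<comment> \<open>\<open>q\<close> is the radial factor of the Jacobian: \<open>J z\<close> is
    \<open>q (norm z)\<close> times the square of |h'|, so pointwise distortion bounds leave radial
    integrands.\<close>
  define q where "q = (\<lambda>\<rho>. 1 - (norm \<zeta>)\<^sup>2 * \<rho> ^ (2 * n))"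
  have q: "0 \<le> q \<rho>" if "0 \<le> \<rho>" "\<rho> \<le> r" for \<rho>
  proof -
    have "(norm \<zeta>)\<^sup>2 * \<rho> ^ (2 * n) \<le> 1 * 1"
      using \<zeta> that r by (intro mult_mono power_le_one) auto
    then show ?thesis by (simp add: q_def)
  qed
  have Jq: "\<bar>J z\<bar> = q (norm z) * (norm (deriv h z))\<^sup>2" if "z \<in> ball 0 r" for z
  proof -
    have "J z = q (norm z) * (norm (deriv h z))\<^sup>2"
      using g'[of z] that r
      by (simp add: J_def q_def norm_mult norm_power power_mult_distrib power_mult[symmetric] algebra_simps)
    then show ?thesis using q[of "norm z"] that by simp
  qed
  have sq: "(x powr (- 2 * (1 - \<alpha>)))\<^sup>2 = 1 / x powr (4 * (1 - \<alpha>))" for x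
  proof -
    have "(x powr (- 2 * (1 - \<alpha>)))\<^sup>2 = x powr (- (4 * (1 - \<alpha>)))"
      by (simp add: power2_eq_square flip: powr_add)
    then show ?thesis by (simp only: powr_minus_divide)
  qed
  define A where "A = measure lebesgue (f ` ball 0 r)"
  have "ennreal (2 * pi * integral {0..r} (\<lambda>\<rho>. \<rho> * (q \<rho> / (1 + \<rho>) powr (4 * (1 - \<alpha>))))) \<le> ennreal A"
  proof -
    have "ennreal (2 * pi * integral {0..r} (\<lambda>\<rho>. \<rho> * (q \<rho> / (1 + \<rho>) powr (4 * (1 - \<alpha>)))))
        = (\<integral>\<^sup>+z\<in>ball (0::complex) r. ennreal (q (norm z) / (1 + norm z) powr (4 * (1 - \<alpha>))) \<partial>lborel)"
      using r q by (intro nn_integral_radial_continuous[symmetric]) (auto simp: q_def intro!: continuous_intros)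
    also have "\<dots> \<le> (\<integral>\<^sup>+z\<in>ball 0 r. ennreal \<bar>J z\<bar> \<partial>lborel)"
    proof (intro nn_integral_mono)
      fix z :: complex
      show "ennreal (q (norm z) / (1 + norm z) powr (4 * (1 - \<alpha>))) * indicator (ball 0 r) z
          \<le> ennreal \<bar>J z\<bar> * indicator (ball 0 r) z"
      proof (cases "z \<in> ball 0 r")
        case True
        have "((1 + norm z) powr (- 2 * (1 - \<alpha>)))\<^sup>2 \<le> (norm (deriv h z))\<^sup>2"
          using convex_order_distortion(1)[OF holh h'0 nz cvx \<alpha>(2), of z] True r
          by (intro power_mono) auto
        then have "q (norm z) * (1 / (1 + norm z) powr (4 * (1 - \<alpha>))) \<le> \<bar>J z\<bar>"
          unfolding sq Jq[OF True] using q[of "norm z"] True by (intro mult_left_mono) auto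
        then show ?thesis by (intro mult_right_mono ennreal_leI) auto
      qed simp
    qed
    finally show ?thesis by (simp add: area A_def)
  qed
  then have lower: "2 * pi * integral {0..r} (\<lambda>\<rho>. \<rho> * (q \<rho> / (1 + \<rho>) powr (4 * (1 - \<alpha>)))) \<le> A"
    by (subst (asm) ennreal_le_iff) (auto simp: A_def)
  \<comment> \<open>\<open>ennreal\<close> sends negative reals to 0, so an inequality between its
    values returns to the reals only when the right-hand side is known to be nonnegative.\<close>
  have upper_nonneg: "0 \<le> integral {0..r} (\<lambda>\<rho>. \<rho> * (q \<rho> / (1 - \<rho>) powr (4 * (1 - \<alpha>))))"
    using q r by (intro integral_nonneg integrable_continuous_interval) (auto simp: q_def intro!: continuous_intros)
  have "ennreal A \<le> ennreal (2 * pi * integral {0..r} (\<lambda>\<rho>. \<rho> * (q \<rho> / (1 - \<rho>) powr (4 * (1 - \<alpha>)))))"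
  proof -
    have "ennreal A = (\<integral>\<^sup>+z\<in>ball 0 r. ennreal \<bar>J z\<bar> \<partial>lborel)" by (simp add: area A_def)
    also have "\<dots> \<le> (\<integral>\<^sup>+z\<in>ball (0::complex) r. ennreal (q (norm z) / (1 - norm z) powr (4 * (1 - \<alpha>))) \<partial>lborel)"
    proof (intro nn_integral_mono)
      fix z :: complex
      show "ennreal \<bar>J z\<bar> * indicator (ball 0 r) z
          \<le> ennreal (q (norm z) / (1 - norm z) powr (4 * (1 - \<alpha>))) * indicator (ball 0 r) z"
      proof (cases "z \<in> ball 0 r")
        case True
        have "(norm (deriv h z))\<^sup>2 \<le> ((1 - norm z) powr (- 2 * (1 - \<alpha>)))\<^sup>2"
          using convex_order_distortion(2)[OF holh h'0 nz cvx \<alpha>(2), of z] True r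
          by (intro power_mono) auto
        then have "\<bar>J z\<bar> \<le> q (norm z) * (1 / (1 - norm z) powr (4 * (1 - \<alpha>)))"
          unfolding sq Jq[OF True] using q[of "norm z"] True by (intro mult_left_mono) auto
        then show ?thesis by (intro mult_right_mono ennreal_leI) auto
      qed simp
    qed
    also have "\<dots> = ennreal (2 * pi * integral {0..r} (\<lambda>\<rho>. \<rho> * (q \<rho> / (1 - \<rho>) powr (4 * (1 - \<alpha>)))))"
      using r q by (intro nn_integral_radial_continuous) (auto simp: q_def intro!: continuous_intros)
    finally show ?thesis .
  qed
  then have upper: "A \<le> 2 * pi * integral {0..r} (\<lambda>\<rho>. \<rho> * (q \<rho> / (1 - \<rho>) powr (4 * (1 - \<alpha>))))"
    by (subst (asm) ennreal_le_iff) (use upper_nonneg in auto)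
  show ?thesis
    using lower upper by (simp add: A_def f_def q_def)
qed

end
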